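(* Let $p\in\mathbb{N}$, let $R$ be a symmetric positive definite $p\times p$ matrix with unit diagonal, let $C$ be a $p\times p$ correlation matrix, let $\alpha<1$, and set $A=\frac{1}{1-\alpha}\,R\odot C$. Then there exists a unique diagonal matrix $D$ with strictly positive diagonal entries such that \[ D A D e = e,\qquad e=(1,\ldots,1)^\top\in\mathbb{R}^p . \] Moreover, if $C$ is positive definite, then all diagonal entries of this $D$ belong to the interval \[ \left[ \frac{\sqrt{(1-\alpha)\lambda_{\min}(C)}}{p} ,\ \sqrt{\frac{p (1-\alpha)}{\lambda_{\min}(C)}}\,\right]. \]
   Context: $\odot$ denotes the Hadamard (entrywise) product. A correlation matrix is a real symmetric positive semidefinite matrix with all diagonal entries equal to $1$. $\lambda_{\min}(C)$ is the smallest eigenvalue of $C$. *)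

theory Defs
  imports "HOL-Analysis.Analysis"
begin

text \<open>
  The product \<open>*\<close> on the type of vectors is componentwise, so on matrices (vectors of
  rows) it is the Hadamard product; the ordinary matrix product is \<open>**\<close>.
\<close>

abbreviation hadamard :: "real^'n^'m \<Rightarrow> real^'n^'m \<Rightarrow> real^'n^'m"  (infixl "\<odot>" 70)
  where "M \<odot> N \<equiv> M * N"

definition symmetric_matrix :: "real^'n^'n \<Rightarrow> bool"
  where "symmetric_matrix M \<longleftrightarrow> transpose M = M"

definition positive_semidefinite :: "real^'n^'n \<Rightarrow> bool"
  where "positive_semidefinite M \<longleftrightarrow> (\<forall>x. x \<bullet> (M *v x) \<ge> 0)"

definition positive_definite :: "real^'n^'n \<Rightarrow> bool"
  where "positive_definite M \<longleftrightarrow> (\<forall>x. x \<noteq> 0 \<longrightarrow> x \<bullet> (M *v x) > 0)"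

definition unit_diagonal :: "real^'n^'n \<Rightarrow> bool"
  where "unit_diagonal M \<longleftrightarrow> (\<forall>i. M $ i $ i = 1)"

definition correlation_matrix :: "real^'n^'n \<Rightarrow> bool"
  where "correlation_matrix M \<longleftrightarrow>
    symmetric_matrix M \<and> positive_semidefinite M \<and> unit_diagonal M"

definition diagonal_matrix :: "real^'n^'n \<Rightarrow> bool"
  where "diagonal_matrix M \<longleftrightarrow> (\<forall>i j. i \<noteq> j \<longrightarrow> M $ i $ j = 0)"

definition real_eigenvalue :: "real^'n^'n \<Rightarrow> real \<Rightarrow> bool"
  where "real_eigenvalue M c \<longleftrightarrow> (\<exists>v. v \<noteq> 0 \<and> M *v v = c *\<^sub>R v)"

text \<open>
  The set of real eigenvalues of a matrix is always finite; it is nonempty for symmetric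
  matrices, and only for those is \<open>lambda_min\<close> used.
\<close>

definition lambda_min :: "real^'n^'n \<Rightarrow> real"
  where "lambda_min M = Min {c. real_eigenvalue M c}"

definition positive_scaling :: "real^'n^'n \<Rightarrow> real^'n^'n \<Rightarrow> bool"
  where "positive_scaling A D \<longleftrightarrow>
    diagonal_matrix D \<and> (\<forall>i. D $ i $ i > 0) \<and> (D ** A ** D) *v (\<chi> i. 1) = (\<chi> i. 1)"

end

theory Submission
  imports Defs
begin

text \<open>
  Writing \<open>d\<close> for the diagonal of \<open>D\<close>, the equation says \<open>d\<^sub>i (A d)\<^sub>i = 1\<close> for all \<open>i\<close>, which is the
  critical point equation of the strictly convex coercive function
  \<open>x \<bullet> A x / 2 - (\<Sum>i. ln x\<^sub>i)\<close> on the positive orthant.  Coercivity holds even for singular \<open>C\<close>: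
  by the Schur product theorem \<open>(R - \<lambda> I) \<odot> C\<close> is positive semidefinite for
  \<open>\<lambda> = \<lambda>\<^sub>m\<^sub>i\<^sub>n(R)\<close>, and \<open>I \<odot> C = I\<close>.  With the roles of \<open>R\<close> and \<open>C\<close> exchanged, the same
  argument turns \<open>d \<bullet> A d = p\<close> into the upper bound on \<open>|d|\<close>; since the entries of \<open>A\<close> are at
  most \<open>1 / (1 - \<alpha>)\<close> in absolute value, this bounds \<open>1 / d\<^sub>i = (A d)\<^sub>i\<close> from above.
\<close>

section \<open>Symmetric positive semidefinite matrices\<close>

lemma symmetric_matrix_nth:
  "symmetric_matrix M \<Longrightarrow> M $ i $ j = M $ j $ i"
  by (simp add: symmetric_matrix_def transpose_def vec_eq_iff)

lemma symmetric_matrixI: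
  "(\<And>i j. M $ i $ j = M $ j $ i) \<Longrightarrow> symmetric_matrix M"
  by (simp add: symmetric_matrix_def transpose_def vec_eq_iff)

lemma symmetric_inner_commute:
  assumes "symmetric_matrix M"
  shows "x \<bullet> (M *v y) = y \<bullet> (M *v x)"
proof -
  have "x \<bullet> (M *v y) = (transpose M *v x) \<bullet> y"
    by (simp only: transpose_matrix_vector dot_lmul_matrix)
  then show ?thesis
    using assms by (simp only: symmetric_matrix_def inner_commute)
qed

lemma inner_matrix_vector_sum:
  fixes M :: "real^'n^'n"
  shows "x \<bullet> (M *v y) = (\<Sum>i\<in>UNIV. \<Sum>j\<in>UNIV. x $ i * M $ i $ j * y $ j)"
  by (simp add: inner_vec_def matrix_vector_mult_def sum_distrib_left mult.assoc)

lemma quadratic_form_add: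
  assumes "symmetric_matrix M"
  shows "(x + t *\<^sub>R y) \<bullet> (M *v (x + t *\<^sub>R y)) =
    x \<bullet> (M *v x) + 2 * t * (y \<bullet> (M *v x)) + t\<^sup>2 * (y \<bullet> (M *v y))"
  using symmetric_inner_commute[OF assms, of x y]
  by (simp add: matrix_vector_right_distrib matrix_vector_mult_scaleR inner_add_left
      inner_add_right power2_eq_square algebra_simps)

text \<open>Evaluate at the vertex \<open>t = - b / c\<close>; for \<open>c = 0\<close> an affine
  function that is nonnegative on the whole line is constant.\<close>

lemma quadratic_nonneg_discriminant:
  fixes a b c :: real
  assumes "c \<ge> 0" and nonneg: "\<And>t. a + 2 * t * b + t\<^sup>2 * c \<ge> 0"
  shows "b\<^sup>2 \<le> a * c"
proof (cases "c = 0")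
  case True
  have "b = 0"
  proof (rule ccontr)
    assume "b \<noteq> 0"
    \<comment> \<open>At this \<open>t\<close> the affine function \<open>a + 2 * t * b\<close>
      takes the value -1.\<close>
    then show False
      using nonneg[of "- (a + 1) / (2 * b)"] True by (simp add: field_simps)
  qed
  then show ?thesis using True by simp
next
  case False
  with \<open>c \<ge> 0\<close> have "c > 0" by simp
  moreover have "a - b\<^sup>2 / c \<ge> 0"
    using nonneg[of "- b / c"] \<open>c > 0\<close> by (simp add: field_simps power2_eq_square)
  ultimately show ?thesis by (simp add: field_simps)
qed

text \<open>The form at \<open>x + t *\<^sub>R y\<close> is a nonnegative quadratic polynomial in
  \<open>t\<close>, so its discriminant is at most 0.\<close>

lemma semidefinite_Cauchy_Schwarz:
  assumes "symmetric_matrix M" "positive_semidefinite M"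
  shows "(y \<bullet> (M *v x))\<^sup>2 \<le> (x \<bullet> (M *v x)) * (y \<bullet> (M *v y))"
  using assms(2) unfolding positive_semidefinite_def
  by (intro quadratic_nonneg_discriminant) (simp_all flip: quadratic_form_add[OF assms(1)])

lemma axis_inner_matrix_vector:
  "axis i 1 \<bullet> ((M :: real^'n^'n) *v x) = (M *v x) $ i"
  by (simp add: inner_axis' )

lemma axis_quadratic_form:
  "axis i 1 \<bullet> ((M :: real^'n^'n) *v axis j 1) = M $ i $ j"
  by (simp add: inner_axis' matrix_vector_mult_basis column_def)

text \<open>With \<open>y = M *v x\<close> in Cauchy-Schwarz, the fourth power of the norm of
  \<open>M *v x\<close> is at most 0.\<close>

lemma semidefinite_kernel:
  assumes "symmetric_matrix M" "positive_semidefinite M" "x \<bullet> (M *v x) = 0"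
  shows "M *v x = 0"
  using semidefinite_Cauchy_Schwarz[OF assms(1,2), where x = x and y = "M *v x"] assms(3) by simp

lemma semidefinite_entry_square_le:
  assumes "symmetric_matrix M" "positive_semidefinite M"
  shows "(M $ i $ j)\<^sup>2 \<le> M $ i $ i * M $ j $ j"
  using semidefinite_Cauchy_Schwarz[OF assms, where x = "axis j 1" and y = "axis i 1"]
  by (simp add: axis_quadratic_form mult.commute)

lemma correlation_matrix_entry_abs_le:
  assumes "correlation_matrix M"
  shows "\<bar>M $ i $ j\<bar> \<le> 1"
  using assms semidefinite_entry_square_le[of M i j]
  by (simp add: correlation_matrix_def unit_diagonal_def abs_square_le_1)

section \<open>The Schur product theorem\<close>

text \<open>Hadamard multiplication by a rank one matrix is congruence by the diagonal matrix of
  \<open>r\<close>, hence preserves semidefiniteness.\<close>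

lemma hadamard_rank_one_quadratic_form:
  fixes M :: "real^'n^'n" and r :: "real^'n"
  shows "x \<bullet> ((M \<odot> (\<chi> i j. r $ i * r $ j)) *v x) = (x * r) \<bullet> (M *v (x * r))"
  by (simp add: inner_matrix_vector_sum algebra_simps)

text \<open>Induction on the support of \<open>N\<close>: subtracting the rank one matrix built from a column of
  \<open>N\<close> clears that row and column (a Cholesky step).  If the pivot vanishes, then so does
  the whole column, and the division by zero is harmless.\<close>

theorem Schur_product:
  fixes M N :: "real^'n^'n"
  assumes M: "positive_semidefinite M"
    and N: "symmetric_matrix N" "positive_semidefinite N"
  shows "positive_semidefinite (M \<odot> N)"
proof -
  have "positive_semidefinite (M \<odot> N)"
    if "finite S" "symmetric_matrix N" "positive_semidefinite N"
      "\<And>i j. i \<notin> S \<Longrightarrow> N $ i $ j = 0" for S and N :: "real^'n^'n"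
    using that
  proof (induction S arbitrary: N rule: finite_induct)
    case empty
    then have "N = 0" by (simp add: vec_eq_iff)
    then show ?case by (simp add: positive_semidefinite_def)
  next
    case (insert a S)
    note sym = insert.prems(1) and psd = insert.prems(2)
    define r where "r = N *v axis a 1"
    define P :: "real^'n^'n" where "P = (\<chi> i j. r $ i * r $ j)"
    define N' where "N' = N - (1 / N $ a $ a) *\<^sub>R P"
    have r: "r $ i = N $ i $ a" for i
      by (simp add: r_def matrix_vector_mult_basis column_def)
    have diag: "N $ a $ a \<ge> 0"
      using psd by (metis axis_quadratic_form positive_semidefinite_def)
    have P_form: "x \<bullet> (P *v x) = (x \<bullet> r)\<^sup>2" for x
      unfolding inner_matrix_vector_sum
      by (simp add: P_def inner_vec_def power2_eq_square sum_product algebra_simps)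
    have sym': "symmetric_matrix N'"
      by (rule symmetric_matrixI)
        (simp add: N'_def P_def symmetric_matrix_nth[OF sym] mult.commute)
    have psd': "positive_semidefinite N'"
      unfolding positive_semidefinite_def
    proof
      fix x
      \<comment> \<open>Cauchy-Schwarz against the basis vector at \<open>a\<close>: the subtracted
        rank one form never exceeds the form of \<open>N\<close>.\<close>
      have "(x \<bullet> r)\<^sup>2 \<le> N $ a $ a * (x \<bullet> (N *v x))"
        using semidefinite_Cauchy_Schwarz[OF sym psd, where x = "axis a 1" and y = x]
        by (simp add: r_def axis_quadratic_form)
      moreover have "x \<bullet> (N *v x) \<ge> 0" using psd by (simp add: positive_semidefinite_def)
      ultimately have "(x \<bullet> r)\<^sup>2 / N $ a $ a \<le> x \<bullet> (N *v x)"
        using diag by (cases "N $ a $ a = 0") (simp_all add: divide_simps mult.commute)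
      then show "x \<bullet> (N' *v x) \<ge> 0"
        by (simp add: N'_def matrix_vector_mult_diff_rdistrib inner_diff_right P_form
            flip: scaleR_matrix_vector_assoc)
    qed
    have zero: "N' $ i $ j = 0" if "i \<notin> S" for i j
    proof (cases "i = a")
      case True
      have "N $ a $ j = 0" if "N $ a $ a = 0"
        using semidefinite_entry_square_le[OF sym psd, of a j] that by simp
      then show ?thesis
        using True by (auto simp: N'_def P_def r symmetric_matrix_nth[OF sym, of j a])
    next
      case False
      then show ?thesis using that insert.prems(3) by (simp add: N'_def P_def r)
    qed
    show ?case
      unfolding positive_semidefinite_def
    proof
      fix x
      \<comment> \<open>The Hadamard product is linear in its second factor: the first term falls to
        the induction hypothesis, the second is a form of \<open>M\<close>.\<close>
      have "M \<odot> N = M \<odot> N' + (1 / N $ a $ a) *\<^sub>R (M \<odot> P)"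
        by (simp add: N'_def vec_eq_iff algebra_simps)
      then have "x \<bullet> ((M \<odot> N) *v x) =
          x \<bullet> ((M \<odot> N') *v x) + (1 / N $ a $ a) * ((x * r) \<bullet> (M *v (x * r)))"
        by (simp add: matrix_vector_mult_add_rdistrib inner_add_right P_def
            hadamard_rank_one_quadratic_form flip: scaleR_matrix_vector_assoc)
      then show "x \<bullet> ((M \<odot> N) *v x) \<ge> 0"
        using insert.IH[OF sym' psd' zero] M diag by (simp add: positive_semidefinite_def)
    qed
  qed
  from this[of UNIV N] show ?thesis using N by simp
qed

section \<open>The smallest eigenvalue\<close>

text \<open>Eigenvectors of distinct eigenvalues are orthogonal, so choosing one for each eigenvalue
  gives an independent, hence finite, family. This makes the \<open>Min\<close> in
  \<open>lambda_min\<close> meaningful.\<close>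

lemma finite_real_eigenvalues:
  fixes M :: "real^'n^'n"
  assumes "symmetric_matrix M"
  shows "finite {c. real_eigenvalue M c}"
proof -
  define v where "v c = (SOME v. v \<noteq> 0 \<and> M *v v = c *\<^sub>R v)" for c
  have v: "v c \<noteq> 0 \<and> M *v v c = c *\<^sub>R v c" if "real_eigenvalue M c" for c
    using that unfolding v_def real_eigenvalue_def by (rule someI_ex)
  have orth: "v c \<bullet> v d = 0" if "real_eigenvalue M c" "real_eigenvalue M d" "c \<noteq> d" for c d
    using symmetric_inner_commute[OF assms, of "v c" "v d"] v[OF that(1)] v[OF that(2)] that(3)
    by (simp add: inner_commute)
  have "inj_on v {c. real_eigenvalue M c}"
    by (rule inj_onI) (use orth v in \<open>metis inner_eq_zero_iff mem_Collect_eq\<close>)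
  moreover have "independent (v ` {c. real_eigenvalue M c})"
  proof (rule pairwise_orthogonal_independent)
    show "pairwise orthogonal (v ` {c. real_eigenvalue M c})"
      unfolding pairwise_def orthogonal_def using orth by (metis imageE mem_Collect_eq)
    show "0 \<notin> v ` {c. real_eigenvalue M c}" using v by auto
  qed
  ultimately show ?thesis
    using independent_imp_finite finite_imageD by blast
qed

text \<open>Both claims come from the minimum \<open>m\<close> of the Rayleigh quotient: it is an
  eigenvalue and bounds every eigenvalue from below.\<close>

lemma lambda_min_symmetric:
  fixes M :: "real^'n^'n"
  assumes sym: "symmetric_matrix M"
  shows "real_eigenvalue M (lambda_min M)"
    and "lambda_min M * (x \<bullet> x) \<le> x \<bullet> (M *v x)"
proof -
  have "\<exists>v\<in>sphere 0 1. \<forall>y\<in>sphere 0 1. v \<bullet> (M *v v) \<le> y \<bullet> (M *v y)"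
  proof (rule continuous_attains_inf)
    show "sphere (0 :: real^'n) 1 \<noteq> {}" by simp
    show "continuous_on (sphere 0 1) (\<lambda>y. y \<bullet> (M *v y))"
      by (intro continuous_intros linear_continuous_on matrix_vector_mul_bounded_linear)
  qed simp
  then obtain v where v: "norm v = 1" "\<And>y. norm y = 1 \<Longrightarrow> v \<bullet> (M *v v) \<le> y \<bullet> (M *v y)"
    by auto
  define m where "m = v \<bullet> (M *v v)"
  have bound: "m * (x \<bullet> x) \<le> x \<bullet> (M *v x)" for x
  proof (cases "x = 0")
    case False
    have "m \<le> (x /\<^sub>R norm x) \<bullet> (M *v (x /\<^sub>R norm x))"
      unfolding m_def by (rule v(2)) (use False in simp)
    then show ?thesis
      using False by (simp add: matrix_vector_mult_scaleR field_simps power2_norm_eq_inner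
          flip: power2_eq_square)
  qed simp
  define N where "N = M - m *\<^sub>R mat 1"
  have N: "N *v x = M *v x - m *\<^sub>R x" for x
    by (simp add: N_def matrix_vector_mult_diff_rdistrib flip: scaleR_matrix_vector_assoc)
  \<comment> \<open>In place of a Lagrange multiplier: the form of the semidefinite matrix
    \<open>N\<close> vanishes at the minimizer \<open>v\<close>, so \<open>v\<close> lies in the
    kernel of \<open>N\<close>.\<close>
  have "N *v v = 0"
  proof (rule semidefinite_kernel)
    show "symmetric_matrix N"
      by (rule symmetric_matrixI) (simp add: N_def mat_def symmetric_matrix_nth[OF sym])
    show "positive_semidefinite N"
      using bound by (simp add: positive_semidefinite_def N inner_diff_right)
    show "v \<bullet> (N *v v) = 0"
      using v(1) by (simp add: N inner_diff_right m_def norm_eq_1)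
  qed
  then have "M *v v = m *\<^sub>R v" by (simp add: N)
  then have eig: "real_eigenvalue M m"
    using v(1) unfolding real_eigenvalue_def by (metis norm_zero zero_neq_one)
  have "m \<le> c" if eigenvalue: "real_eigenvalue M c" for c
  proof -
    obtain w where w: "w \<noteq> 0" "M *v w = c *\<^sub>R w"
      using eigenvalue by (auto simp: real_eigenvalue_def)
    then show ?thesis using bound[of w] by simp
  qed
  then have "lambda_min M = m"
    unfolding lambda_min_def using eig finite_real_eigenvalues[OF sym] by (intro Min_eqI) auto
  then show "real_eigenvalue M (lambda_min M)" "lambda_min M * (x \<bullet> x) \<le> x \<bullet> (M *v x)"
    using eig bound by auto
qed

lemma lambda_min_pos:
  assumes "symmetric_matrix M" "positive_definite M"
  shows "lambda_min M > 0"
proof -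
  obtain v where v: "v \<noteq> 0" "M *v v = lambda_min M *\<^sub>R v"
    using lambda_min_symmetric(1)[OF assms(1)] by (auto simp: real_eigenvalue_def)
  then have "0 < lambda_min M * (v \<bullet> v)"
    using assms(2) by (metis inner_scaleR_right positive_definite_def)
  then show ?thesis using v(1) by (metis inner_gt_zero_iff zero_less_mult_pos2)
qed

text \<open>Shifting \<open>M\<close> by its smallest eigenvalue leaves a semidefinite matrix, and
  the unit diagonal of \<open>N\<close> gives \<open>mat 1 \<odot> N = mat 1\<close>.\<close>

lemma hadamard_correlation_lower_bound:
  fixes M N :: "real^'n^'n"
  assumes M: "symmetric_matrix M" and N: "correlation_matrix N"
  shows "lambda_min M * (x \<bullet> x) \<le> x \<bullet> ((M \<odot> N) *v x)"
proof -
  define M' where "M' = M - lambda_min M *\<^sub>R mat 1"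
  have "positive_semidefinite M'"
    using lambda_min_symmetric(2)[OF M]
    by (simp add: positive_semidefinite_def M'_def matrix_vector_mult_diff_rdistrib
        inner_diff_right flip: scaleR_matrix_vector_assoc)
  then have "positive_semidefinite (M' \<odot> N)"
    using N by (intro Schur_product) (auto simp: correlation_matrix_def)
  moreover have "M' \<odot> N = M \<odot> N - lambda_min M *\<^sub>R mat 1"
    using N by (auto simp: M'_def vec_eq_iff mat_def correlation_matrix_def unit_diagonal_def
        algebra_simps)
  ultimately show ?thesis
    by (simp add: positive_semidefinite_def matrix_vector_mult_diff_rdistrib
        inner_diff_right flip: scaleR_matrix_vector_assoc)
qed

section \<open>Scaling of positive definite matrices\<close>

lemma diagonal_conjugate_mult_one:
  fixes A D :: "real^'n^'n"
  assumes "diagonal_matrix D"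
  shows "((D ** A ** D) *v (\<chi> i. 1)) $ i = D $ i $ i * (A *v (\<chi> i. D $ i $ i)) $ i"
proof -
  have D: "(D *v x) $ k = D $ k $ k * x $ k" for x k
  proof -
    have "(D *v x) $ k = (\<Sum>j\<in>UNIV. if j = k then D $ k $ k * x $ k else 0)"
      unfolding matrix_vector_mult_def vec_lambda_beta
      by (intro sum.cong) (use assms in \<open>auto simp: diagonal_matrix_def\<close>)
    then show ?thesis by simp
  qed
  have "D *v (\<chi> i. 1) = (\<chi> i. D $ i $ i)"
    by (simp add: vec_eq_iff D)
  then have "(D ** A ** D) *v (\<chi> i. 1) = D *v (A *v (\<chi> i. D $ i $ i))"
    by (metis matrix_vector_mul_assoc)
  then show ?thesis
    by (simp only: D)
qed

lemma positive_scaling_iff: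
  "positive_scaling A D \<longleftrightarrow> diagonal_matrix D \<and>
    (\<forall>i. D $ i $ i > 0 \<and> D $ i $ i * (A *v (\<chi> i. D $ i $ i)) $ i = 1)"
  by (auto simp: positive_scaling_def diagonal_conjugate_mult_one vec_eq_iff)

text \<open>Monotonicity of \<open>A\<close> against antitonicity of \<open>t \<mapsto> 1 / t\<close>.\<close>

lemma scaling_vector_unique:
  fixes A :: "real^'n^'n" and x y :: "real^'n"
  assumes A: "positive_definite A"
    and x: "\<And>i. x $ i > 0" "\<And>i. x $ i * (A *v x) $ i = 1"
    and y: "\<And>i. y $ i > 0" "\<And>i. y $ i * (A *v y) $ i = 1"
  shows "x = y"
proof (rule ccontr)
  assume "x \<noteq> y"
  then have "(x - y) \<bullet> (A *v (x - y)) > 0"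
    using A by (simp add: positive_definite_def)
  moreover have "(x - y) \<bullet> (A *v (x - y)) \<le> 0"
    unfolding inner_vec_def
  proof (rule sum_nonpos)
    fix i
    have "(A *v x) $ i = 1 / x $ i" "(A *v y) $ i = 1 / y $ i"
      using x(1)[of i] x(2)[of i] y(1)[of i] y(2)[of i] by (simp_all add: field_simps)
    then have "(x - y) $ i * (A *v (x - y)) $ i = (x $ i - y $ i) * (1 / x $ i - 1 / y $ i)"
      by (simp add: matrix_vector_mult_diff_distrib)
    also have "\<dots> = - ((x $ i - y $ i)\<^sup>2 / (x $ i * y $ i))"
      using x(1)[of i] y(1)[of i] by (simp add: field_simps power2_eq_square)
    also have "\<dots> \<le> 0" using x(1)[of i] y(1)[of i] by simp
    finally show "(x - y) $ i \<bullet> (A *v (x - y)) $ i \<le> 0" by simp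
  qed
  ultimately show False by simp
qed

section \<open>Existence of a scaling by minimizing the barrier function\<close>

definition barrier :: "real^'n^'n \<Rightarrow> real^'n \<Rightarrow> real"
  where "barrier A x = x \<bullet> (A *v x) / 2 - (\<Sum>i\<in>UNIV. ln (x $ i))"

text \<open>Points with a smaller value than the all-ones vector \<open>1\<close> lie in a compact
  box inside the open orthant, so a minimizer on that box is global.\<close>

lemma barrier_minimizer_exists:
  fixes A :: "real^'n^'n"
  assumes "c > 0" and A: "\<And>x. c * (x \<bullet> x) \<le> x \<bullet> (A *v x)"
  obtains x where "\<And>i. x $ i > 0"
    and "\<And>y. (\<And>i. y $ i > 0) \<Longrightarrow> barrier A x \<le> barrier A y"
proof -
  \<comment> \<open>Replacing \<open>A\<close> by \<open>c\<close> times the identity bounds the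
    barrier from below by a sum of values of \<open>g\<close>, one for each coordinate.\<close>
  define g where "g t = c / 2 * t\<^sup>2 - ln t" for t
  have square: "c / 2 * t\<^sup>2 \<ge> t - 1 / (2 * c)" for t
  proof -
    have "0 \<le> (c * t - 1)\<^sup>2 / (2 * c)" using \<open>c > 0\<close> by simp
    also have "\<dots> = c / 2 * t\<^sup>2 - t + 1 / (2 * c)"
      using \<open>c > 0\<close> by (simp add: field_simps power2_eq_square)
    finally show ?thesis by simp
  qed
  have g_ge: "0 \<le> g t + 1 / (2 * c)" if "t > 0" for t
    using square[of t] ln_le_minus_one[OF that] by (simp add: g_def)
  \<comment> \<open>Adding \<open>1 / (2 * c)\<close> makes every summand nonnegative, so below the
    level \<open>barrier A 1\<close> each single one is at most \<open>K\<close>. The box bounds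
    \<open>l\<close> and \<open>u\<close> follow from this; \<open>min\<close> and
    \<open>max\<close> with 1 keep the vector \<open>1\<close> in the box.\<close>
  define K where "K = barrier A 1 + real CARD('n) * (1 / (2 * c))"
  define l where "l = min 1 (exp (- K))"
  define u where "u = max 1 (1 + (K + 1 / c) * (4 / c))"
  have l: "l > 0" "l \<le> 1" and u: "u \<ge> 1" by (auto simp: l_def u_def)
  have outside: "l \<le> y $ i \<and> y $ i \<le> u"
    if pos: "\<And>i. y $ i > 0" and small: "barrier A y < barrier A 1" for y i
  proof -
    have "(\<Sum>j\<in>UNIV. g (y $ j)) = c * (y \<bullet> y) / 2 - (\<Sum>j\<in>UNIV. ln (y $ j))"
      by (simp add: g_def sum_subtractf inner_vec_def sum_distrib_left sum_divide_distrib
          power2_eq_square)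
    also have "\<dots> \<le> barrier A y" using A[of y] by (simp add: barrier_def)
    finally have "(\<Sum>j\<in>UNIV. g (y $ j)) \<le> barrier A 1" using small by simp
    then have "(\<Sum>j\<in>UNIV. g (y $ j) + 1 / (2 * c)) \<le> K"
      by (simp add: sum.distrib K_def)
    moreover have "g (y $ i) + 1 / (2 * c) \<le> (\<Sum>j\<in>UNIV. g (y $ j) + 1 / (2 * c))"
      using g_ge[OF pos] by (intro member_le_sum) auto
    ultimately have gK: "g (y $ i) + 1 / (2 * c) \<le> K" by simp
    define t where "t = y $ i"
    have t: "t > 0" using pos by (simp add: t_def)
    have c_pos: "1 / (2 * c) > 0" using \<open>c > 0\<close> by simp
    have gt: "c / 2 * t\<^sup>2 - ln t + 1 / (2 * c) \<le> K" using gK by (simp add: g_def t_def)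
    have "- K \<le> ln t"
      using gt c_pos \<open>c > 0\<close> by (smt (verit) mult_nonneg_nonneg zero_le_power2 half_gt_zero)
    then have "exp (- K) \<le> t" using t by (simp add: ln_ge_iff)
    moreover have "t \<le> 1 + (K + 1 / c) * (4 / c)"
    proof -
      \<comment> \<open>Half of the quadratic term absorbs \<open>ln t \<le> t - 1\<close>; the
        other half bounds \<open>t\<^sup>2\<close>.\<close>
      have "0 \<le> (c * t / 2 - 1)\<^sup>2 / c" using \<open>c > 0\<close> by simp
      also have "\<dots> = c / 4 * t\<^sup>2 - t + 1 / c"
        using \<open>c > 0\<close> by (simp add: field_simps power2_eq_square)
      finally have "c / 4 * t\<^sup>2 \<le> K + 1 / c"
        using gt ln_le_minus_one[OF t] c_pos by linarith
      then have "t\<^sup>2 \<le> (K + 1 / c) * (4 / c)"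
        using \<open>c > 0\<close> by (simp add: field_simps)
      moreover have "0 \<le> (t - 1 / 2)\<^sup>2" by simp
      then have "t \<le> 1 + t\<^sup>2" by (simp add: power2_eq_square algebra_simps)
      ultimately show ?thesis by simp
    qed
    ultimately show ?thesis unfolding t_def l_def u_def by auto
  qed
  define B :: "(real^'n) set" where "B = cbox (\<chi> i. l) (\<chi> i. u)"
  have B: "x \<in> B \<longleftrightarrow> (\<forall>i. l \<le> x $ i \<and> x $ i \<le> u)" for x
    by (simp add: B_def mem_box_cart)
  have "1 \<in> B" using l u by (simp add: B)
  have "\<exists>x\<in>B. \<forall>y\<in>B. barrier A x \<le> barrier A y"
  proof (rule continuous_attains_inf)
    show "compact B" by (simp add: B_def)
    show "B \<noteq> {}" using \<open>1 \<in> B\<close> by auto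
    have "x $ i \<noteq> 0" if "x \<in> B" for x i
      using that l(1) unfolding B by (metis not_less)
    then show "continuous_on B (barrier A)"
      unfolding barrier_def
      by (intro continuous_intros linear_continuous_on matrix_vector_mul_bounded_linear) auto
  qed
  then obtain x where x: "x \<in> B" "\<And>y. y \<in> B \<Longrightarrow> barrier A x \<le> barrier A y" by blast
  show thesis
  proof
    show "x $ i > 0" for i using x(1) l(1) unfolding B by (metis less_le_trans)
    \<comment> \<open>Outside the box the value is at least \<open>barrier A 1\<close>, which is at
      least the minimum on the box.\<close>
    show "barrier A x \<le> barrier A y" if "\<And>i. y $ i > 0" for y
      using x(2)[of y] x(2)[OF \<open>1 \<in> B\<close>] outside[OF that] by (force simp: B)
  qed
qed

text \<open>At a minimizer of the barrier each partial derivative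
  \<open>(A *v x) $ i - 1 / x $ i\<close> vanishes.\<close>

lemma scaling_vector_exists:
  fixes A :: "real^'n^'n"
  assumes sym: "symmetric_matrix A"
    and "c > 0" and A: "\<And>x. c * (x \<bullet> x) \<le> x \<bullet> (A *v x)"
  obtains x where "\<And>i. x $ i > 0" and "\<And>i. x $ i * (A *v x) $ i = 1"
proof -
  obtain x where pos: "\<And>i. x $ i > 0"
    and min: "\<And>y. (\<And>i. y $ i > 0) \<Longrightarrow> barrier A x \<le> barrier A y"
    using barrier_minimizer_exists[OF \<open>c > 0\<close> A] by blast
  have "x $ i * (A *v x) $ i = 1" for i
  proof -
    \<comment> \<open>\<open>h\<close> collects the terms of the barrier that vary along the
      coordinate axis \<open>i\<close> through \<open>x\<close>.\<close>
    define h where "h t = t * (A *v x) $ i + t\<^sup>2 * A $ i $ i / 2 - ln (x $ i + t)" for t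
    have barrier: "barrier A (x + t *\<^sub>R axis i 1)
        = h t + x \<bullet> (A *v x) / 2 - (\<Sum>j\<in>UNIV - {i}. ln (x $ j))" for t
    proof -
      have "(\<Sum>j\<in>UNIV. ln ((x + t *\<^sub>R axis i 1) $ j)) =
          ln (x $ i + t) + (\<Sum>j\<in>UNIV - {i}. ln (x $ j))"
        by (subst sum.remove[of _ i]) (auto simp: axis_def intro!: sum.cong)
      then show ?thesis
        by (simp add: barrier_def h_def quadratic_form_add[OF sym] axis_inner_matrix_vector
            axis_quadratic_form[unfolded axis_inner_matrix_vector])
    qed
    have deriv: "(h has_real_derivative ((A *v x) $ i - 1 / x $ i)) (at 0)"
      unfolding h_def using pos[of i] by (auto intro!: derivative_eq_intros simp: field_simps)
    \<comment> \<open>The radius \<open>x $ i\<close> keeps the shifted point in the positive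
      orthant.\<close>
    have "h 0 \<le> h t" if "\<bar>0 - t\<bar> < x $ i" for t
    proof -
      have "(x + t *\<^sub>R axis i 1) $ j > 0" for j
        using that pos[of j] by (auto simp: axis_def)
      from min[OF this] show ?thesis
        using barrier[of t] barrier[of 0] by simp
    qed
    then have "(A *v x) $ i - 1 / x $ i = 0"
      using DERIV_local_min[OF deriv pos[of i]] by blast
    then show ?thesis using pos[of i] by (simp add: field_simps)
  qed
  with pos show thesis using that by blast
qed

lemma positive_scaling_ex1:
  fixes A :: "real^'n^'n"
  assumes sym: "symmetric_matrix A"
    and "c > 0" and A: "\<And>x. c * (x \<bullet> x) \<le> x \<bullet> (A *v x)"
  shows "\<exists>!D. positive_scaling A D"
proof -
  have pd: "positive_definite A"
    using A \<open>c > 0\<close> unfolding positive_definite_def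
    by (metis inner_gt_zero_iff less_le_trans mult_pos_pos)
  obtain x where x: "\<And>i. x $ i > 0" "\<And>i. x $ i * (A *v x) $ i = 1"
    using scaling_vector_exists[OF assms] by blast
  show ?thesis
  proof
    show "positive_scaling A (\<chi> i j. if i = j then x $ i else 0)"
      using x by (simp add: positive_scaling_iff diagonal_matrix_def)
  next
    fix D assume D: "positive_scaling A D"
    then have "(\<chi> i. D $ i $ i) = x"
      unfolding positive_scaling_iff by (intro scaling_vector_unique[OF pd _ _ x]) auto
    then show "D = (\<chi> i j. if i = j then x $ i else 0)"
      using D by (auto simp: vec_eq_iff positive_scaling_iff diagonal_matrix_def)
  qed
qed

section \<open>Bounds on the entries of a scaling\<close>

lemma positive_scaling_norm_le:
  fixes A D :: "real^'n^'n"
  assumes "c > 0" and A: "\<And>x. c * (x \<bullet> x) \<le> x \<bullet> (A *v x)" and D: "positive_scaling A D"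
  shows "norm (\<chi> i. D $ i $ i) \<le> sqrt (real CARD('n) / c)"
proof -
  define d :: "real^'n" where "d = (\<chi> i. D $ i $ i)"
  have "d \<bullet> (A *v d) = real CARD('n)"
    using D by (simp add: positive_scaling_iff d_def inner_vec_def)
  then have "d \<bullet> d \<le> real CARD('n) / c"
    using A[of d] \<open>c > 0\<close> by (simp add: field_simps)
  then show ?thesis by (simp add: norm_eq_sqrt_inner flip: d_def)
qed

lemma sum_abs_le_sqrt_card_norm:
  fixes x :: "real^'n"
  shows "(\<Sum>i\<in>UNIV. \<bar>x $ i\<bar>) \<le> sqrt (real CARD('n)) * norm x"
proof -
  have "(\<Sum>i\<in>UNIV. \<bar>x $ i\<bar>) = (\<chi> i. 1) \<bullet> (\<chi> i. \<bar>x $ i\<bar>)"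
    by (simp add: inner_vec_def)
  also have "\<dots> \<le> norm ((\<chi> i. 1) :: real^'n) * norm (\<chi> i. \<bar>x $ i\<bar>)"
    by (rule norm_cauchy_schwarz)
  also have "\<dots> = sqrt (real CARD('n)) * norm x"
    by (simp add: norm_vec_def L2_set_def)
  finally show ?thesis .
qed

text \<open>Bound \<open>(A *v d) $ i\<close>, the reciprocal of \<open>d $ i\<close>, from above.
  The comparison of the 1-norm with the 2-norm and the norm bound on \<open>d\<close> each
  contribute a factor \<open>sqrt (real CARD('n))\<close>.\<close>

lemma positive_scaling_entry_ge:
  fixes A D :: "real^'n^'n"
  assumes "b > 0" "c > 0" and A: "\<And>x. c * (x \<bullet> x) \<le> x \<bullet> (A *v x)"
    and entries: "\<And>i j. \<bar>A $ i $ j\<bar> \<le> b" and D: "positive_scaling A D"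
  shows "sqrt c / (b * real CARD('n)) \<le> D $ i $ i"
proof -
  define d :: "real^'n" where "d = (\<chi> i. D $ i $ i)"
  have d: "d $ i > 0" "d $ i * (A *v d) $ i = 1"
    using D by (simp_all add: positive_scaling_iff d_def)
  have "(A *v d) $ i \<le> (\<Sum>j\<in>UNIV. b * \<bar>d $ j\<bar>)"
    unfolding matrix_vector_mult_def vec_lambda_beta
    by (intro sum_mono) (metis abs_ge_self abs_ge_zero abs_mult entries mult_right_mono order_trans)
  also have "\<dots> = b * (\<Sum>j\<in>UNIV. \<bar>d $ j\<bar>)"
    by (simp add: sum_distrib_left)
  also have "\<dots> \<le> b * (sqrt (real CARD('n)) * norm d)"
    using \<open>b > 0\<close> by (intro mult_left_mono sum_abs_le_sqrt_card_norm) simp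
  also have "\<dots> \<le> b * (sqrt (real CARD('n)) * sqrt (real CARD('n) / c))"
    using \<open>b > 0\<close> positive_scaling_norm_le[OF \<open>c > 0\<close> A D]
    by (intro mult_left_mono) (auto simp: d_def)
  also have "\<dots> = b * real CARD('n) / sqrt c"
    by (simp add: real_sqrt_divide)
  finally have "d $ i * (A *v d) $ i \<le> d $ i * (b * real CARD('n) / sqrt c)"
    using d(1) by (intro mult_left_mono) auto
  then have "1 \<le> d $ i * (b * real CARD('n) / sqrt c)"
    using d(2) by simp
  then show ?thesis
    using \<open>b > 0\<close> \<open>c > 0\<close> by (simp add: field_simps d_def)
qed

theorem theorem1:
  fixes R C A :: "real^'n^'n" and \<alpha> :: real
  assumes "symmetric_matrix R" and "positive_definite R" and "unit_diagonal R"
    and "correlation_matrix C"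
    and "\<alpha> < 1"
    and "A = (1 / (1 - \<alpha>)) *\<^sub>R (R \<odot> C)"
  shows "(\<exists>!D. positive_scaling A D) \<and>
    (positive_definite C \<longrightarrow>
      (\<forall>D. positive_scaling A D \<longrightarrow>
        (\<forall>i. D $ i $ i \<in> {sqrt ((1 - \<alpha>) * lambda_min C) / real CARD('n) ..
                         sqrt (real CARD('n) * (1 - \<alpha>) / lambda_min C)})))"
proof (intro conjI impI allI)
  have C: "symmetric_matrix C" using assms(4) by (simp add: correlation_matrix_def)
  have R: "correlation_matrix R"
    using assms(1-3) unfolding correlation_matrix_def positive_semidefinite_def
      positive_definite_def by (metis inner_zero_left less_imp_le order_refl)
  have form: "x \<bullet> (A *v x) = (x \<bullet> ((R \<odot> C) *v x)) / (1 - \<alpha>)" for x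
    by (simp add: assms(6) flip: scaleR_matrix_vector_assoc)
  \<comment> \<open>This constant is positive for every correlation matrix \<open>C\<close> and
    drives existence and uniqueness.\<close>
  have bound_R: "lambda_min R / (1 - \<alpha>) * (x \<bullet> x) \<le> x \<bullet> (A *v x)" for x
    using hadamard_correlation_lower_bound[OF assms(1,4), of x] assms(5)
    by (simp add: form divide_right_mono)
  \<comment> \<open>\<open>R\<close> is itself a correlation matrix and the Hadamard product
    commutes, so the two factors may be exchanged; this constant enters the interval.\<close>
  have bound_C: "lambda_min C / (1 - \<alpha>) * (x \<bullet> x) \<le> x \<bullet> (A *v x)" for x
    using hadamard_correlation_lower_bound[OF C R, of x] assms(5)
    by (simp add: form divide_right_mono mult.commute[of R])
  have "symmetric_matrix A"
    by (rule symmetric_matrixI)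
      (simp add: assms(6) symmetric_matrix_nth[OF C] symmetric_matrix_nth[OF assms(1)])
  then show "\<exists>!D. positive_scaling A D"
    using lambda_min_pos[OF assms(1,2)] assms(5)
    by (intro positive_scaling_ex1[OF _ _ bound_R]) auto
  fix D i assume "positive_definite C" and D: "positive_scaling A D"
  then have lambda: "lambda_min C / (1 - \<alpha>) > 0"
    using lambda_min_pos[OF C] assms(5) by simp
  have "D $ i $ i \<le> norm (\<chi> i. D $ i $ i)"
    using component_le_norm_cart[of "\<chi> i. D $ i $ i" i] by simp
  also have "\<dots> \<le> sqrt (real CARD('n) / (lambda_min C / (1 - \<alpha>)))"
    by (rule positive_scaling_norm_le[OF lambda bound_C D])
  finally have upper: "D $ i $ i \<le> sqrt (real CARD('n) * (1 - \<alpha>) / lambda_min C)"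
    by simp
  have "\<bar>A $ j $ k\<bar> \<le> 1 / (1 - \<alpha>)" for j k
    using mult_le_one[OF correlation_matrix_entry_abs_le[OF R, of j k] _
        correlation_matrix_entry_abs_le[OF assms(4), of j k]] assms(5)
    by (simp add: assms(6) abs_mult divide_right_mono)
  then have "sqrt (lambda_min C / (1 - \<alpha>)) / (1 / (1 - \<alpha>) * real CARD('n)) \<le> D $ i $ i"
    using assms(5) by (intro positive_scaling_entry_ge[OF _ lambda bound_C _ D]) auto
  \<comment> \<open>Rewrites the entry bound with \<open>b = 1 / (1 - \<alpha>)\<close> and
    \<open>c = lambda_min C / (1 - \<alpha>)\<close> into the stated left endpoint.\<close>
  moreover have "sqrt (lambda_min C / (1 - \<alpha>)) * (1 - \<alpha>) = sqrt ((1 - \<alpha>) * lambda_min C)"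
  proof -
    have "sqrt (lambda_min C / (1 - \<alpha>)) * (1 - \<alpha>) =
        sqrt (lambda_min C) * ((1 - \<alpha>) / sqrt (1 - \<alpha>))"
      by (simp add: real_sqrt_divide)
    also have "(1 - \<alpha>) / sqrt (1 - \<alpha>) = sqrt (1 - \<alpha>)"
      using assms(5) by (intro real_div_sqrt) simp
    finally show ?thesis by (simp only: real_sqrt_mult mult.commute)
  qed
  ultimately show "D $ i $ i \<in> {sqrt ((1 - \<alpha>) * lambda_min C) / real CARD('n) ..
      sqrt (real CARD('n) * (1 - \<alpha>) / lambda_min C)}"
    using upper by simp
qed

end
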